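(* Let $m>1$ and $n\ge 1$ be integers. For $i\in\{1,\dots,m\}$ let $A_i\in\mathbb{R}^{n_i\times n}$ and $b_i\in\mathbb{R}^{n_i}$, let $A$ be the matrix obtained by stacking $A_1,\dots,A_m$ and $b$ the vector obtained by stacking $b_1,\dots,b_m$, and suppose that $Ax=b$ has a unique solution $x^*$. Let $P_i$ be the orthogonal projection matrix onto $\ker A_i$. Let $q=(m-1)^2$, let $\mathcal{C}$ be the set of all products $P_{j_1}P_{j_2}\cdots P_{j_{q+1}}$ of length $q+1$ with $j_1,\dots,j_{q+1}\in\{1,\dots,m\}$ in which each of $P_1,\dots,P_m$ occurs at least once (i.e. $\{j_1,\dots,j_{q+1}\}=\{1,\dots,m\}$), and set $$\rho=\max_{\mathcal{C}}|P_{j_1}P_{j_2}\cdots P_{j_{q+1}}|_2,\qquad \lambda=\Bigl(1-\frac{(m-1)(1-\rho)}{m^q}\Bigr)^{1/q},$$ where $|\cdot|_2$ is the induced two-norm. Let $\mathbb{N}(t)$, $t\ge1$, be a sequence of neighbor graphs with neighbor sets $\mathcal{N}_i(t)$, let $m_i(t)$ be the number of elements of $\mathcal{N}_i(t)$, and suppose that each agent $i$ has a state $x_i(t)\in\mathbb{R}^n$ with $A_ix_i(1)=b_i$, updated by $$x_i(t+1)=x_i(t)-\frac{1}{m_i(t)}P_i\Bigl(m_i(t)x_i(t)-\sum_{j\in\mathcal{N}_i(t)}x_j(t)\Bigr),\qquad t\ge 1 .$$ If each of the neighbor graphs $\mathbb{N}(t)$, $t\ge1$, is strongly connected, then all $x_i(t)$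 converge to $x^*$ as $t\to\infty$ as fast as $\lambda^t$ converges to $0$.
   Context: Neighbor graphs: there are $m$ agents labelled $1,\dots,m$. At each time $t$ agent $i$ has a set of neighbors $\mathcal{N}_i(t)\subset\{1,\dots,m\}$ with $i\in\mathcal{N}_i(t)$ always. $\mathbb{N}(t)$ is the directed graph on $\{1,\dots,m\}$ with an arc from $j$ to $i$ exactly when $j\in\mathcal{N}_i(t)$. "$x_i(t)$ converges to $x^*$ as fast as $\lambda^t$ converges to $0$" means that there is a constant $c$ with $|x_i(t)-x^*|_2\le c\lambda^t$ for all $t\ge1$. *)

theory Defs
  imports "HOL-Analysis.Analysis" "Graph_Theory.Digraph_Component"
begin

(* The number of rows of A_i varies with the agent i, so it cannot be a type index.
   A matrix with k rows and columns indexed by 'n is the list of its k rows. *)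
type_synonym 'n rows = "(real ^ 'n) list"

definition rows_mult :: "'n::finite rows \<Rightarrow> real ^ 'n \<Rightarrow> real list" where
  "rows_mult R y = map (\<lambda>r. r \<bullet> y) R"

definition rows_ker :: "'n::finite rows \<Rightarrow> (real ^ 'n) set" where
  "rows_ker R = {y. rows_mult R y = replicate (length R) 0}"

(* [f 1, ..., f m] concatenated: stacks m matrices (lists of rows) or m vectors (lists of entries). *)
definition stack :: "nat \<Rightarrow> (nat \<Rightarrow> 'a list) \<Rightarrow> 'a list" where
  "stack m f = concat (map f [1..<Suc m])"

definition is_orth_proj_matrix :: "real ^ 'n ^ 'n \<Rightarrow> (real ^ 'n) set \<Rightarrow> bool" where
  "is_orth_proj_matrix Q V \<longleftrightarrow>
     (\<forall>y. Q *v y \<in> V \<and> (\<forall>v\<in>V. orthogonal (y - Q *v y) v))"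

definition two_norm :: "real ^ 'n ^ 'n \<Rightarrow> real" where
  "two_norm M = onorm (\<lambda>y. M *v y)"

definition mat_prod_list :: "(real ^ 'n ^ 'n) list \<Rightarrow> real ^ 'n ^ 'n" where
  "mat_prod_list Ms = foldr (**) Ms (mat 1)"

definition complete_products :: "nat \<Rightarrow> nat \<Rightarrow> (nat \<Rightarrow> real ^ 'n ^ 'n) \<Rightarrow> (real ^ 'n ^ 'n) set" where
  "complete_products m q P =
     {mat_prod_list (map P js) | js. length js = q + 1 \<and> set js = {1..m}}"

definition q_of :: "nat \<Rightarrow> nat" where
  "q_of m = (m - 1) ^ 2"

definition rho :: "nat \<Rightarrow> (nat \<Rightarrow> real ^ 'n ^ 'n) \<Rightarrow> real" where
  "rho m P = Max (two_norm ` complete_products m (q_of m) P)"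

definition rate :: "nat \<Rightarrow> (nat \<Rightarrow> real ^ 'n ^ 'n) \<Rightarrow> real" where
  "rate m P = (1 - (real m - 1) * (1 - rho m P) / real m ^ q_of m) powr (1 / real (q_of m))"

(* S i is the neighbor set of i; information flows from a neighbor j to i. *)
definition neighbor_graph :: "nat \<Rightarrow> (nat \<Rightarrow> nat set) \<Rightarrow> (nat, nat \<times> nat) pre_digraph" where
  "neighbor_graph m S =
     \<lparr> verts = {1..m}, arcs = {(j, i). i \<in> {1..m} \<and> j \<in> S i}, tail = fst, head = snd \<rparr>"

definition converges_as_fast :: "(nat \<Rightarrow> real ^ 'n) \<Rightarrow> real ^ 'n \<Rightarrow> real \<Rightarrow> bool" where
  "converges_as_fast y l r \<longleftrightarrow> (\<exists>c. \<forall>t\<ge>1. norm (y t - l) \<le> c * r ^ t)"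

end

(* The error x i t - xstar lies in the kernel of A i, so after q rounds it is a weighted sum, over the
   backward walks of length q through the neighbor graphs, of products of q + 1 projections applied to
   old errors. The weights of the walks add up to 1, each of them being at least 1 / m^q. By strong
   connectivity, any agent reaches any other in m - 1 steps, so within q = (m - 1)^2 steps a walk from i
   can visit all m - 1 other agents and end at any one of them. This gives m - 1 walks whose
   product contracts by the factor rho, the other products being nonexpansive. *)

theory Submission
  imports Defs
begin

section \<open>Matrix products and the induced two-norm\<close>

lemma mat_prod_list_vector_simps [simp]:
  "mat_prod_list [] *v y = y"
  "mat_prod_list (M # Ms) *v y = M *v (mat_prod_list Ms *v y)"
  by (simp_all add: mat_prod_list_def matrix_vector_mul_assoc)

lemma mat_prod_list_append_vector:
  "mat_prod_list (Ms @ Ms') *v y = mat_prod_list Ms *v (mat_prod_list Ms' *v y)"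
  by (induction Ms) simp_all

lemma norm_matrix_vector_le_two_norm: "norm (M *v y) \<le> two_norm M * norm y"
  unfolding two_norm_def by (rule onorm) (rule matrix_vector_mul_bounded_linear)

lemma two_norm_nonneg: "0 \<le> two_norm M"
  unfolding two_norm_def by (rule onorm_pos_le) (rule matrix_vector_mul_bounded_linear)

text \<open>By compactness the norm is attained at some unit vector \<open>u\<close>, where the
  strict inequality applies. A supremum that is not attained could still equal 1.\<close>

lemma two_norm_less_1:
  fixes M :: "real ^ 'n ^ 'n"
  assumes "\<And>y. y \<noteq> 0 \<Longrightarrow> norm (M *v y) < norm y"
  shows "two_norm M < 1"
proof -
  have "continuous_on (sphere 0 1) (\<lambda>y. norm (M *v y))"
    by (intro continuous_intros matrix_vector_mult_linear_continuous_on)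
  moreover have "sphere (0 :: real ^ 'n) 1 \<noteq> {}"
    by simp
  ultimately obtain u where u: "norm u = 1" "\<And>y. norm y = 1 \<Longrightarrow> norm (M *v y) \<le> norm (M *v u)"
    using continuous_attains_sup[of "sphere (0 :: real ^ 'n) 1" "\<lambda>y. norm (M *v y)"] by auto
  have "norm (M *v y) \<le> norm (M *v u) * norm y" for y
  proof (cases "y = 0")
    case False
    have "norm (M *v (inverse (norm y) *\<^sub>R y)) \<le> norm (M *v u)"
      using False by (intro u) simp
    then show ?thesis
      using False by (simp add: matrix_vector_mult_scaleR field_simps)
  qed simp
  then have "two_norm M \<le> norm (M *v u)"
    unfolding two_norm_def by (rule onorm_le)
  also have "\<dots> < 1"
    using assms[of u] u(1) by fastforce
  finally show ?thesis .
qed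

section \<open>Orthogonal projections\<close>

lemma orth_proj_norm_sq:
  assumes "is_orth_proj_matrix Q V"
  shows "norm y ^ 2 = norm (Q *v y) ^ 2 + norm (y - Q *v y) ^ 2"
proof -
  have "orthogonal (Q *v y) (y - Q *v y)"
    using assms by (auto simp: is_orth_proj_matrix_def orthogonal_commute)
  from norm_add_Pythagorean[OF this] show ?thesis
    by simp
qed

lemma orth_proj_norm_le:
  assumes "is_orth_proj_matrix Q V"
  shows "norm (Q *v y) \<le> norm y"
proof (rule power2_le_imp_le)
  show "(norm (Q *v y))\<^sup>2 \<le> (norm y)\<^sup>2"
    unfolding orth_proj_norm_sq[OF assms, of y] by (rule add_increasing2) simp_all
qed simp

lemma orth_proj_norm_eq_imp_mem:
  assumes "is_orth_proj_matrix Q V" "norm (Q *v y) = norm y"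
  shows "y \<in> V"
proof -
  have "y = Q *v y"
    using orth_proj_norm_sq[OF assms(1), of y] assms(2) by simp
  then show ?thesis
    using assms(1) unfolding is_orth_proj_matrix_def by metis
qed

lemma orth_proj_fixes:
  assumes "is_orth_proj_matrix Q V" "subspace V" "y \<in> V"
  shows "Q *v y = y"
proof -
  have "y - Q *v y \<in> V"
    using assms by (simp add: is_orth_proj_matrix_def subspace_diff)
  then have "orthogonal (y - Q *v y) (y - Q *v y)"
    using assms(1) by (simp add: is_orth_proj_matrix_def)
  then show ?thesis
    by (simp add: orthogonal_self)
qed

section \<open>Kernels and stacked systems\<close>

lemma mem_rows_ker_iff: "y \<in> rows_ker R \<longleftrightarrow> (\<forall>r\<in>set R. r \<bullet> y = 0)"
  unfolding rows_ker_def rows_mult_def mem_Collect_eq by (induction R) auto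

lemma subspace_rows_ker: "subspace (rows_ker R)"
  by (simp add: subspace_def mem_rows_ker_iff inner_add_right)

lemma diff_mem_rows_ker_iff: "y - z \<in> rows_ker R \<longleftrightarrow> rows_mult R y = rows_mult R z"
  by (simp add: mem_rows_ker_iff rows_mult_def inner_diff_right)

text \<open>Matching block lengths make the concatenation injective, so a stacked system splits into
  the systems of the agents.\<close>

lemma stack_eq_iff:
  assumes "\<And>i. i \<in> {1..m} \<Longrightarrow> length (f i) = length (g i)"
  shows "stack m f = stack m g \<longleftrightarrow> (\<forall>i\<in>{1..m}. f i = g i)"
proof -
  have "stack m f = stack m g \<longleftrightarrow> map f [1..<Suc m] = map g [1..<Suc m]"
    unfolding stack_def using assms
    by (intro concat_eq_concat_iff) (auto simp: zip_map_map zip_same_conv_map simp del: upt_Suc)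
  then show ?thesis
    by (auto simp del: upt_Suc)
qed

lemma rows_mult_stack: "rows_mult (stack m A) y = stack m (\<lambda>i. rows_mult (A i) y)"
  by (simp add: stack_def rows_mult_def map_concat o_def del: upt_Suc)

section \<open>Products of projections\<close>

lemma mat_prod_list_proj_norm_le:
  assumes "\<And>j. j \<in> set js \<Longrightarrow> is_orth_proj_matrix (P j) (V j)"
  shows "norm (mat_prod_list (map P js) *v y) \<le> norm y"
  using assms
proof (induction js)
  case (Cons j js)
  have "norm (P j *v (mat_prod_list (map P js) *v y)) \<le> norm (mat_prod_list (map P js) *v y)"
    using Cons.prems by (intro orth_proj_norm_le[of _ "V j"]) simp
  also have "\<dots> \<le> norm y"
    using Cons by simp
  finally show ?case
    by simp
qed simp

lemma mat_prod_list_fixes: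
  assumes "\<And>j. j \<in> set js \<Longrightarrow> P j *v y = y"
  shows "mat_prod_list (map P js) *v y = y"
  using assms by (induction js) simp_all

text \<open>No factor increases the norm, so none may decrease it either. By induction the inner
  factors fix \<open>y\<close>; the outermost one then preserves the norm of \<open>y\<close>
  itself.\<close>

lemma mat_prod_list_proj_norm_eq:
  assumes "\<And>j. j \<in> set js \<Longrightarrow> is_orth_proj_matrix (P j) (V j)" "\<And>j. j \<in> set js \<Longrightarrow> subspace (V j)"
    and "norm (mat_prod_list (map P js) *v y) = norm y" "j \<in> set js"
  shows "y \<in> V j"
  using assms
proof (induction js arbitrary: j)
  case (Cons a js)
  let ?z = "mat_prod_list (map P js) *v y"
  have Pa: "is_orth_proj_matrix (P a) (V a)"
    using Cons.prems(1) by simp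
  have "norm ?z \<le> norm y"
    using Cons.prems(1) by (intro mat_prod_list_proj_norm_le) auto
  moreover have "norm y \<le> norm ?z"
    using Cons.prems(3) orth_proj_norm_le[OF Pa, of ?z] by simp
  ultimately have z: "norm ?z = norm y"
    by simp
  have mem: "y \<in> V i" if "i \<in> set js" for i
    using Cons.IH[OF _ _ z that] Cons.prems(1,2) by simp
  have "?z = y"
    using mem Cons.prems(1,2) by (intro mat_prod_list_fixes orth_proj_fixes[of _ "V _"]) auto
  then have "y \<in> V a"
    using Cons.prems(3) by (intro orth_proj_norm_eq_imp_mem[OF Pa]) simp
  then show ?case
    using mem Cons.prems(4) by auto
qed simp

section \<open>The bounds 0 \<le> rho < 1\<close>

lemma finite_complete_products: "finite (complete_products m q P)"
proof -
  have "finite {js. set js \<subseteq> {1..m} \<and> length js = q + 1}"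
    by (rule finite_lists_length_eq) simp
  moreover have "complete_products m q P
      \<subseteq> (\<lambda>js. mat_prod_list (map P js)) ` {js. set js \<subseteq> {1..m} \<and> length js = q + 1}"
    by (auto simp: complete_products_def)
  ultimately show ?thesis
    by (rule finite_surj)
qed

text \<open>Since m - 1 \<le> (m - 1)^2, the list 1, ..., m fits into length q + 1 and can be padded
  with 1s. This makes the \<open>Max\<close> in \<open>rho\<close> a genuine maximum.\<close>

lemma complete_products_nonempty:
  assumes "1 < m"
  shows "complete_products m (q_of m) P \<noteq> {}"
proof -
  let ?js = "[1..<Suc m] @ replicate (q_of m + 1 - m) 1"
  have "m - 1 \<le> q_of m"
    using assms by (simp add: q_of_def power2_eq_square)
  then have "length ?js = q_of m + 1" "set ?js = {1..m}"
    using assms by (auto simp del: upt_Suc)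
  then show ?thesis
    unfolding complete_products_def by blast
qed

lemma two_norm_le_rho:
  assumes "length js = q_of m + 1" "set js = {1..m}"
  shows "two_norm (mat_prod_list (map P js)) \<le> rho m P"
  unfolding rho_def using assms
  by (intro Max_ge finite_imageI finite_complete_products imageI)
    (unfold complete_products_def, blast)

lemma rho_nonneg:
  assumes "1 < m"
  shows "0 \<le> rho m P"
proof -
  have "rho m P \<in> two_norm ` complete_products m (q_of m) P"
    unfolding rho_def using assms
    by (intro Max_in finite_imageI finite_complete_products) (simp add: complete_products_nonempty)
  then show ?thesis
    by (auto simp: two_norm_nonneg)
qed

text \<open>A complete product that preserves the norm of \<open>y\<close> puts \<open>y\<close>
  into every \<open>V j\<close>, hence \<open>y = 0\<close>. So each of the finitely many norms is
  below 1.\<close>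

lemma rho_less_1:
  assumes "1 < m"
    and "\<And>j. j \<in> {1..m} \<Longrightarrow> is_orth_proj_matrix (P j) (V j)" "\<And>j. j \<in> {1..m} \<Longrightarrow> subspace (V j)"
    and trivial: "\<And>y. (\<And>j. j \<in> {1..m} \<Longrightarrow> y \<in> V j) \<Longrightarrow> y = 0"
  shows "rho m P < 1"
proof -
  have "two_norm (mat_prod_list (map P js)) < 1" if js: "set js = {1..m}" for js
  proof (rule two_norm_less_1)
    fix y :: "real ^ 'a"
    assume "y \<noteq> 0"
    then have "norm (mat_prod_list (map P js) *v y) \<noteq> norm y"
      using mat_prod_list_proj_norm_eq[of js P V y] trivial[of y] assms(2,3) js by blast
    moreover have "norm (mat_prod_list (map P js) *v y) \<le> norm y"
      using assms(2) js by (intro mat_prod_list_proj_norm_le) auto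
    ultimately show "norm (mat_prod_list (map P js) *v y) < norm y"
      by simp
  qed
  then show ?thesis
    unfolding rho_def using assms(1)
    by (subst Max_less_iff)
      (auto simp: finite_complete_products complete_products_nonempty, auto simp: complete_products_def)
qed

section \<open>Walks that visit every vertex\<close>

text \<open>With \<open>G k i\<close> the set of possible predecessors of \<open>i\<close> at level \<open>k\<close>, the set
  \<open>covering_ends U G V k i\<close> consists of the endpoints of those walks from level \<open>k\<close> down to level 0,
  starting at \<open>i\<close>, whose vertices together with \<open>V\<close> exhaust \<open>U\<close>.\<close>

fun covering_ends :: "'a set \<Rightarrow> (nat \<Rightarrow> 'a \<Rightarrow> 'a set) \<Rightarrow> 'a set \<Rightarrow> nat \<Rightarrow> 'a \<Rightarrow> 'a set" where
  "covering_ends U G V 0 i = (if insert i V = U then {i} else {})"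
| "covering_ends U G V (Suc k) i = (\<Union>j\<in>G k i. covering_ends U G (insert i V) k j)"

lemma covering_ends_insert: "covering_ends U G (insert i V) k i = covering_ends U G V k i"
  by (cases k) simp_all

text \<open>Strong connectivity enters through \<open>G_expands\<close>: no nonempty proper subset
  of \<open>U\<close> contains all predecessors of its members. The graphs may differ from level to
  level.\<close>

context
  fixes U :: "'a set" and G :: "nat \<Rightarrow> 'a \<Rightarrow> 'a set"
  assumes finite_U: "finite U"
    and G_subset: "\<And>k i. i \<in> U \<Longrightarrow> G k i \<subseteq> U"
    and G_refl: "\<And>k i. i \<in> U \<Longrightarrow> i \<in> G k i"
    and G_expands: "\<And>k S. S \<subset> U \<Longrightarrow> S \<noteq> {} \<Longrightarrow> \<exists>i\<in>S. \<not> G k i \<subseteq> S"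
begin

lemma covering_ends_subset: "i \<in> U \<Longrightarrow> covering_ends U G V k i \<subseteq> U"
proof (induction k arbitrary: V i)
  case (Suc k)
  then show ?case
    using G_subset[OF Suc.prems, of k] by (simp add: UN_subset_iff) blast
qed simp

lemma covering_ends_mono:
  "V \<subseteq> V' \<Longrightarrow> V' \<subseteq> U \<Longrightarrow> i \<in> U \<Longrightarrow> covering_ends U G V k i \<subseteq> covering_ends U G V' k i"
proof (induction k arbitrary: V V' i)
  case (Suc k)
  have "covering_ends U G (insert i V) k j \<subseteq> covering_ends U G (insert i V') k j" if "j \<in> G k i" for j
    using Suc.prems that G_subset[of i k] by (intro Suc.IH) auto
  then show ?case
    by fastforce
qed auto

text \<open>Passing to predecessors enlarges \<open>S\<close> by at least one vertex per level until
  it is all of \<open>U\<close>, so \<open>s\<close> levels suffice for some walk from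
  \<open>S\<close> to reach \<open>w\<close>. Generalizing from a vertex to a set lets the induction
  follow this growth.\<close>

lemma covering_ends_via_set:
  assumes "S \<subseteq> U" "S \<noteq> {}" "card U \<le> card S + s" "V \<subseteq> U" "w \<in> U"
  shows "\<exists>i\<in>S. covering_ends U G V k w \<subseteq> covering_ends U G V (k + s) i"
  using assms(1-3)
proof (induction s arbitrary: S)
  case 0
  then have "S = U"
    using finite_U by (intro card_seteq) auto
  then show ?case
    using assms by auto
next
  case (Suc s)
  define S' where "S' = (\<Union>i\<in>S. G (k + s) i)"
  have "S \<subseteq> S'"
    using Suc.prems(1) G_refl by (auto simp: S'_def)
  moreover have "S' \<subseteq> U"
    unfolding S'_def using Suc.prems(1) by (intro UN_least G_subset) auto
  ultimately have S': "S \<subseteq> S'" "S' \<subseteq> U"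
    by simp_all
  have "card U \<le> card S' + s"
  proof (cases "S = U")
    case True
    then show ?thesis
      using S' by (simp add: subset_antisym)
  next
    case False
    then obtain i where "i \<in> S" "\<not> G (k + s) i \<subseteq> S"
      using G_expands[of S "k + s"] Suc.prems(1,2) by auto
    then have "S \<subset> S'"
      using S'(1) by (auto simp: S'_def)
    then have "card S < card S'"
      using S' finite_U by (intro psubset_card_mono) (auto intro: finite_subset)
    then show ?thesis
      using Suc.prems by simp
  qed
  then obtain j where j: "j \<in> S'" "covering_ends U G V k w \<subseteq> covering_ends U G V (k + s) j"
    using Suc.IH[of S'] S' Suc.prems by auto
  then obtain i where i: "i \<in> S" "j \<in> G (k + s) i"
    by (auto simp: S'_def)
  have "covering_ends U G V (k + s) j \<subseteq> covering_ends U G (insert i V) (k + s) j"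
    using assms i Suc.prems S' j by (intro covering_ends_mono) auto
  \<comment> \<open>Passing through \<open>i\<close> adds it to the visited set, which can only
    enlarge the set of endpoints.\<close>
  also have "\<dots> \<subseteq> covering_ends U G V (k + Suc s) i"
    using i by auto
  finally show ?case
    using j i by blast
qed

lemma covering_ends_via:
  assumes "V \<subseteq> U" "i \<in> U" "w \<in> U"
  shows "covering_ends U G (insert i V) k w \<subseteq> covering_ends U G V (k + (card U - 1)) i"
  using covering_ends_via_set[of "{i}" "card U - 1" "insert i V" w k] assms
  by (simp add: covering_ends_insert)

text \<open>The vertices of \<open>ws\<close> are visited in order, each by a detour of
  \<open>card U - 1\<close> levels; vertices met on the way do no harm.\<close>

lemma last_mem_covering_ends:
  assumes "V \<subseteq> U" "i \<in> U" "set ws \<subseteq> U" "insert i V \<union> set ws = U"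
  shows "last (i # ws) \<in> covering_ends U G V (length ws * (card U - 1)) i"
  using assms
proof (induction ws arbitrary: V i)
  case (Cons w ws)
  have "last (w # ws) \<in> covering_ends U G (insert i V) (length ws * (card U - 1)) w"
    using Cons.prems by (intro Cons.IH) auto
  also have "\<dots> \<subseteq> covering_ends U G V (length ws * (card U - 1) + (card U - 1)) i"
    using Cons.prems by (intro covering_ends_via) auto
  finally show ?case
    by (simp add: add.commute)
qed simp

text \<open>Every \<open>j\<close> other than \<open>i\<close> is an endpoint: visit the remaining
  vertices in any order and \<open>j\<close> last. These are \<open>card U - 1\<close> targets at
  \<open>card U - 1\<close> levels each, which explains the square.\<close>

lemma card_covering_ends_ge:
  assumes "i \<in> U"
  shows "card U - 1 \<le> card (covering_ends U G {} ((card U - 1)\<^sup>2) i)"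
proof -
  have "j \<in> covering_ends U G {} ((card U - 1)\<^sup>2) i" if j: "j \<in> U - {i}" for j
  proof -
    obtain ws where ws: "set ws = U - {i, j}" "distinct ws"
      using finite_distinct_list[of "U - {i, j}"] finite_U by auto
    have "set (ws @ [j]) = U - {i}" "distinct (ws @ [j])"
      using ws j by auto
    then have "length (ws @ [j]) = card U - 1"
      using assms distinct_card[of "ws @ [j]"] by simp
    then show ?thesis
      using last_mem_covering_ends[of "{}" i "ws @ [j]"] assms ws j
      by (auto simp: power2_eq_square insert_absorb)
  qed
  then have "card (U - {i}) \<le> card (covering_ends U G {} ((card U - 1)\<^sup>2) i)"
    using finite_subset[OF covering_ends_subset finite_U] assms by (intro card_mono) auto
  then show ?thesis
    using assms by simp
qed

end

section \<open>Strong connectivity as expansion\<close>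

lemma neighbor_graph_expands:
  assumes "strongly_connected (neighbor_graph m S)" "X \<subset> {1..m}" "X \<noteq> {}"
  shows "\<exists>i\<in>X. \<not> S i \<subseteq> X"
proof (rule ccontr)
  assume closed: "\<not> (\<exists>i\<in>X. \<not> S i \<subseteq> X)"
  obtain u v where uv: "u \<in> {1..m} - X" "v \<in> X"
    using assms by blast
  have "u \<rightarrow>\<^sup>*\<^bsub>neighbor_graph m S\<^esub> v"
    using assms uv by (auto simp: strongly_connected_def neighbor_graph_def)
  then have "(u, v) \<in> rtrancl_on {1..m} (arcs_ends (neighbor_graph m S))"
    by (simp add: reachable_def neighbor_graph_def)
  then have "v \<notin> X"
  proof (induction rule: rtrancl_on_induct)
    case base
    then show ?case
      using uv by simp
  next
    case (step y z)
    then show ?case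
      using closed by (auto simp: arcs_ends_def arc_to_ends_def neighbor_graph_def)
  qed
  then show False
    using uv by simp
qed

text \<open>One averaging round of the walk estimate: with at most \<open>m\<close> terms in the
  average, each saving \<open>d j\<close> keeps at least the fraction \<open>1 / m\<close> of its
  weight.\<close>

lemma averaged_contraction_le:
  fixes d :: "'a \<Rightarrow> nat" and E r M D :: real
  assumes "finite S" "S \<noteq> {}" "real (card S) \<le> m" "0 \<le> E" "r \<le> 1" "0 < M"
    and D: "D \<le> (\<Sum>j\<in>S. real (d j))" "0 \<le> D"
  shows "(\<Sum>j\<in>S. (1 - (1 - r) * real (d j) / M) * E) / real (card S) \<le> (1 - (1 - r) * D / (m * M)) * E"
proof -
  have c: "0 < real (card S)"
    using assms by (simp add: card_gt_0_iff)
  have "(\<Sum>j\<in>S. (1 - (1 - r) * real (d j) / M)) / real (card S)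
      = 1 - (1 - r) * (\<Sum>j\<in>S. real (d j)) / (real (card S) * M)"
    using c \<open>0 < M\<close>
    by (simp add: sum_subtractf diff_divide_distrib mult.commute
        flip: sum_distrib_left sum_divide_distrib)
  also have "\<dots> \<le> 1 - (1 - r) * D / (m * M)"
  proof (intro diff_left_mono frac_le mult_left_mono mult_right_mono mult_nonneg_nonneg)
    show "0 < real (card S) * M"
      using c \<open>0 < M\<close> by simp
  qed (use assms in \<open>simp_all add: sum_nonneg\<close>)
  finally have "(\<Sum>j\<in>S. (1 - (1 - r) * real (d j) / M)) / real (card S) * E
      \<le> (1 - (1 - r) * D / (m * M)) * E"
    using \<open>0 \<le> E\<close> by (rule mult_right_mono)
  then show ?thesis
    by (simp flip: sum_distrib_right)
qed

text \<open>Induction in strides of \<open>q\<close>. For \<open>t\<close> up to \<open>q\<close>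
  the constant \<open>C / r ^ q\<close> works because \<open>r ^ t\<close> is at least
  \<open>r ^ q\<close>.\<close>

lemma geometric_decay:
  fixes a :: "'i \<Rightarrow> nat \<Rightarrow> real"
  assumes "0 < r" "r \<le> 1" "0 < q" "0 \<le> C"
    and init: "\<And>i t. i \<in> U \<Longrightarrow> 1 \<le> t \<Longrightarrow> t \<le> q \<Longrightarrow> a i t \<le> C"
    and step: "\<And>t i E. 1 \<le> t \<Longrightarrow> (\<And>j. j \<in> U \<Longrightarrow> a j t \<le> E) \<Longrightarrow> i \<in> U \<Longrightarrow> a i (t + q) \<le> r ^ q * E"
    and "1 \<le> t" "i \<in> U"
  shows "a i t \<le> C / r ^ q * r ^ t"
  using assms(7,8)
proof (induction t arbitrary: i rule: less_induct)
  case (less t)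
  show ?case
  proof (cases "t \<le> q")
    case True
    have "a i t * r ^ q \<le> C * r ^ q"
      using init[OF less.prems(2,1) True] \<open>0 < r\<close> by simp
    also have "\<dots> \<le> C * r ^ t"
      using True assms by (intro mult_left_mono power_decreasing) auto
    finally show ?thesis
      using \<open>0 < r\<close> by (simp add: field_simps)
  next
    case False
    then have "a i ((t - q) + q) \<le> r ^ q * (C / r ^ q * r ^ (t - q))"
      using less \<open>0 < q\<close> by (intro step) auto
    also have "\<dots> = C / r ^ q * r ^ (t - q + q)"
      by (simp add: power_add)
    finally show ?thesis
      using False by simp
  qed
qed

section \<open>Convergence of the iteration\<close>

theorem corollary1:
  fixes m :: nat
    and nr :: "nat \<Rightarrow> nat"
    and A :: "nat \<Rightarrow> 'n::finite rows"
    and b :: "nat \<Rightarrow> real list"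
    and xstar :: "real ^ 'n"
    and P :: "nat \<Rightarrow> real ^ 'n ^ 'n"
    and N :: "nat \<Rightarrow> nat \<Rightarrow> nat set"
    and x :: "nat \<Rightarrow> nat \<Rightarrow> real ^ 'n"
  assumes m_gt: "m > 1"
    and A_dim: "\<And>i. i \<in> {1..m} \<Longrightarrow> length (A i) = nr i"
    and b_dim: "\<And>i. i \<in> {1..m} \<Longrightarrow> length (b i) = nr i"
    and xstar_sol: "rows_mult (stack m A) xstar = stack m b"
    and xstar_unique: "\<And>y. rows_mult (stack m A) y = stack m b \<Longrightarrow> y = xstar"
    and P_proj: "\<And>i. i \<in> {1..m} \<Longrightarrow> is_orth_proj_matrix (P i) (rows_ker (A i))"
    and N_sub: "\<And>i t. i \<in> {1..m} \<Longrightarrow> t \<ge> 1 \<Longrightarrow> N i t \<subseteq> {1..m}"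
    and N_self: "\<And>i t. i \<in> {1..m} \<Longrightarrow> t \<ge> 1 \<Longrightarrow> i \<in> N i t"
    and x_init: "\<And>i. i \<in> {1..m} \<Longrightarrow> rows_mult (A i) (x i 1) = b i"
    and x_update: "\<And>i t. i \<in> {1..m} \<Longrightarrow> t \<ge> 1 \<Longrightarrow>
          x i (t + 1) = x i t - (1 / real (card (N i t))) *\<^sub>R
            (P i *v (real (card (N i t)) *\<^sub>R x i t - (\<Sum>j\<in>N i t. x j t)))"
    and N_conn: "\<And>t. t \<ge> 1 \<Longrightarrow> strongly_connected (neighbor_graph m (\<lambda>i. N i t))"
  shows "\<forall>i\<in>{1..m}. (x i \<longlonglongrightarrow> xstar) \<and> converges_as_fast (x i) xstar (rate m P)"
proof -
  define U where "U = {1..m}"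
  define q where "q = q_of m"
  define lam where "lam = rate m P"
  define e where "e i t = x i t - xstar" for i t
  let ?K = "\<lambda>i. rows_ker (A i)"
  have q: "q = (card U - 1)\<^sup>2" "0 < q"
    using m_gt by (simp_all add: q_def q_of_def U_def)
  have NU: "N i t \<subseteq> U" "i \<in> N i t" "finite (N i t)" "0 < card (N i t)" "card (N i t) \<le> m"
    if "i \<in> U" "1 \<le> t" for i t
  proof -
    show 1: "N i t \<subseteq> U" "i \<in> N i t"
      using N_sub N_self that by (auto simp: U_def)
    then show "finite (N i t)"
      using finite_subset[of "N i t" U] by (simp add: U_def)
    then show "0 < card (N i t)" "card (N i t) \<le> m"
      using 1 card_mono[of U "N i t"] by (auto simp: card_gt_0_iff U_def)
  qed
  have "\<forall>i\<in>{1..m}. rows_mult (A i) xstar = b i"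
    using xstar_sol A_dim b_dim unfolding rows_mult_stack
    by (subst (asm) stack_eq_iff) (simp_all add: rows_mult_def)
  then have xstar_i: "rows_mult (A i) xstar = b i" if "i \<in> U" for i
    using that by (simp add: U_def)
  have P: "is_orth_proj_matrix (P i) (?K i)" if "i \<in> U" for i
    using P_proj that by (simp add: U_def)
  have "rho m P < 1"
  proof (rule rho_less_1[where V = ?K])
    fix y :: "real ^ 'n"
    assume y: "\<And>j. j \<in> {1..m} \<Longrightarrow> y \<in> rows_ker (A j)"
    \<comment> \<open>A common kernel vector \<open>y\<close> yields a further solution
      \<open>xstar + y\<close>; here uniqueness makes the kernels intersect trivially.\<close>
    have "rows_mult (A i) (xstar + y) = b i" if "i \<in> U" for i
      using y[of i] diff_mem_rows_ker_iff[of "xstar + y" xstar "A i"] xstar_i[OF that] that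
      by (simp add: U_def)
    then have "map (\<lambda>i. rows_mult (A i) (xstar + y)) [1..<Suc m] = map b [1..<Suc m]"
      by (intro map_cong refl) (simp add: U_def del: upt_Suc)
    then have "rows_mult (stack m A) (xstar + y) = stack m b"
      unfolding rows_mult_stack unfolding stack_def by (rule arg_cong)
    then show "y = 0"
      using xstar_unique by fastforce
  qed (use m_gt P_proj subspace_rows_ker in auto)
  have "0 \<le> rho m P"
    using m_gt by (rule rho_nonneg)

  \<comment> \<open>Recursion for the errors\<close>
  have e_Suc: "e i (Suc t) = P i *v ((1 / real (card (N i t))) *\<^sub>R (\<Sum>j\<in>N i t. e j t))"
    if "i \<in> U" "1 \<le> t" "e i t \<in> ?K i" for i t
  proof -
    let ?c = "real (card (N i t))"
    have c: "?c \<noteq> 0"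
      using NU[OF that(1,2)] by auto
    have "?c *\<^sub>R x i t - (\<Sum>j\<in>N i t. x j t) = ?c *\<^sub>R e i t - (\<Sum>j\<in>N i t. e j t)"
      by (simp add: e_def sum_subtractf scaleR_diff_right sum_constant_scaleR del: sum_constant)
    then have "e i (Suc t) = e i t - (1 / ?c) *\<^sub>R (P i *v (?c *\<^sub>R e i t - (\<Sum>j\<in>N i t. e j t)))"
      using x_update[of i t] that by (simp add: U_def e_def)
    \<comment> \<open>The first two terms cancel because \<open>P i\<close> fixes
      \<open>e i t\<close>, leaving only the projected average.\<close>
    also have "\<dots> = e i t - P i *v e i t + P i *v ((1 / ?c) *\<^sub>R (\<Sum>j\<in>N i t. e j t))"
      using c by (simp add: matrix_vector_mult_diff_distrib matrix_vector_mult_scaleR scaleR_diff_right)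
    finally show ?thesis
      using orth_proj_fixes[OF P[OF that(1)] subspace_rows_ker that(3)] by simp
  qed
  have e_ker: "e i t \<in> ?K i" if "i \<in> U" "1 \<le> t" for i t
    using that(2)
  proof (induction t rule: dec_induct)
    case base
    then show ?case
      using x_init xstar_i that by (simp add: e_def diff_mem_rows_ker_iff U_def)
  next
    case (step t)
    then show ?case
      using e_Suc[OF that(1) step(1) step(3)] P[OF that(1)] by (simp add: is_orth_proj_matrix_def)
  qed
  have Pe: "P i *v e i t = e i t" if "i \<in> U" "1 \<le> t" for i t
    using orth_proj_fixes[OF P subspace_rows_ker e_ker] that by blast

  \<comment> \<open>Estimate over backward walks\<close>
  have walk_bound: "norm (mat_prod_list (map P (js @ [i])) *v e i (t + k))
      \<le> (1 - (1 - rho m P) * real (card (covering_ends U (\<lambda>l i. N i (t + l)) (set js) k i)) / real m ^ k) * E"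
    if "1 \<le> t" "\<And>j. j \<in> U \<Longrightarrow> norm (e j t) \<le> E" "0 \<le> E"
      "length js + k = q" "set js \<subseteq> U" "i \<in> U" for js k i t E
    \<comment> \<open>\<open>js\<close> lists the agents visited so far, \<open>i\<close> is the
      current one and \<open>k\<close> rounds remain. Each distinct endpoint of a covering walk
      saves \<open>1 - rho m P\<close> with weight at least \<open>1 / m ^ k\<close>.\<close>
    using that(4-6)
  proof (induction k arbitrary: js i)
    case 0
    let ?M = "mat_prod_list (map P (js @ [i]))"
    have "norm (?M *v e i t) \<le> norm (e i t)"
      using P 0 by (intro mat_prod_list_proj_norm_le[where V = ?K]) auto
    then have le_E: "norm (?M *v e i t) \<le> E"
      using that(2)[OF 0(3)] by simp
    \<comment> \<open>At level 0 the count is 1 or 0. If all agents have been visited, the product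
      has length \<open>q + 1\<close> and is one of those bounded by \<open>rho\<close>.\<close>
    have "norm (?M *v e i t) \<le> rho m P * E" if "insert i (set js) = U"
    proof -
      have "two_norm ?M \<le> rho m P"
        using that 0 by (intro two_norm_le_rho) (auto simp: q_def U_def)
      then have "two_norm ?M * norm (e i t) \<le> rho m P * E"
        using \<open>0 \<le> rho m P\<close> \<open>\<And>j. j \<in> U \<Longrightarrow> norm (e j t) \<le> E\<close>[OF 0(3)] by (intro mult_mono) auto
      then show ?thesis
        using norm_matrix_vector_le_two_norm[of ?M "e i t"] by linarith
    qed
    then show ?case
      using le_E by simp
  next
    case (Suc k)
    let ?M = "mat_prod_list (map P (js @ [i]))" and ?N = "N i (t + k)"
    define D where "D j = covering_ends U (\<lambda>l i. N i (t + l)) (set (js @ [i])) k j" for j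
    note N = NU[OF Suc.prems(3), of "t + k"]
    have N_le: "1 \<le> t + k"
      using that(1) by simp
    \<comment> \<open>The last factor of \<open>?M\<close> is already \<open>P i\<close>, so it
      absorbs the projection coming from the error recursion.\<close>
    have M_idem: "?M *v (P i *v y) = ?M *v y" for y
      using orth_proj_fixes[OF P subspace_rows_ker, of i "P i *v y"] P Suc.prems(3)
      by (simp add: mat_prod_list_append_vector is_orth_proj_matrix_def)
    have "?M *v e i (t + Suc k) = ?M *v ((1 / real (card ?N)) *\<^sub>R (\<Sum>j\<in>?N. e j (t + k)))"
      using e_Suc[OF Suc.prems(3) N_le e_ker[OF Suc.prems(3) N_le]] by (simp only: add_Suc_right M_idem)
    also have "\<dots> = (1 / real (card ?N)) *\<^sub>R (\<Sum>j\<in>?N. ?M *v e j (t + k))"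
      by (simp add: matrix_vector_mult_scaleR linear_sum[OF matrix_vector_mul_linear])
    also have "norm \<dots> \<le> (\<Sum>j\<in>?N. norm (?M *v e j (t + k))) / real (card ?N)"
      using norm_sum[of "\<lambda>j. ?M *v e j (t + k)" ?N] by (simp add: divide_right_mono)
    also have "\<dots> \<le> (\<Sum>j\<in>?N. (1 - (1 - rho m P) * real (card (D j)) / real m ^ k) * E) / real (card ?N)"
    proof (intro divide_right_mono sum_mono)
      fix j
      assume "j \<in> ?N"
      then have j: "j \<in> U"
        using N N_le by auto
      \<comment> \<open>The factor \<open>P j\<close> can be appended freely since it fixes the
        error of \<open>j\<close>; this extends the walk to \<open>j\<close>.\<close>
      have "?M *v e j (t + k) = mat_prod_list (map P ((js @ [i]) @ [j])) *v e j (t + k)"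
        using Pe[OF j N_le] by (simp add: mat_prod_list_append_vector)
      then show "norm (?M *v e j (t + k)) \<le> (1 - (1 - rho m P) * real (card (D j)) / real m ^ k) * E"
        using Suc.IH[of "js @ [i]" j] Suc.prems j by (simp add: D_def)
    qed simp
    \<comment> \<open>Walks through different predecessors may share endpoints, so the union only
      bounds the sum of the counts from below.\<close>
    also have "\<dots> \<le> (1 - (1 - rho m P) * real (card (\<Union>j\<in>?N. D j)) / (real m * real m ^ k)) * E"
    proof (rule averaged_contraction_le)
      show "real (card (\<Union>j\<in>?N. D j)) \<le> (\<Sum>j\<in>?N. real (card (D j)))"
        using card_UN_le[of ?N D] N N_le by (simp flip: of_nat_sum)
    qed (use N N_le \<open>0 \<le> E\<close> \<open>rho m P < 1\<close> m_gt in auto)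
    finally show ?case
      by (simp add: D_def)
  qed

  \<comment> \<open>Contraction over q rounds\<close>
  define base where "base = 1 - (real m - 1) * (1 - rho m P) / real m ^ q"
  \<comment> \<open>Positivity of \<open>base\<close> is needed for \<open>powr\<close> to act as a
    true q-th root, giving \<open>lam ^ q = base\<close>, and for dividing by \<open>lam ^ q\<close>
    later.\<close>
  have "real m \<le> real m ^ q"
    using m_gt q(2) by (intro self_le_power) auto
  have "(real m - 1) * (1 - rho m P) \<le> real m - 1"
    using \<open>0 \<le> rho m P\<close> m_gt by (simp add: mult_left_le)
  also have "\<dots> < real m ^ q"
    using \<open>real m \<le> real m ^ q\<close> by linarith
  finally have "0 < base"
    using m_gt by (simp add: base_def)
  have "base < 1"
    using \<open>rho m P < 1\<close> m_gt by (simp add: base_def)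
  have lam: "lam = base powr (1 / real q)"
    by (simp add: lam_def rate_def base_def q_def)
  have "0 < lam"
    using \<open>0 < base\<close> lam by simp
  have lam_q: "lam ^ q = base"
    using \<open>0 < base\<close> \<open>0 < lam\<close> q(2) by (simp add: lam powr_powr flip: powr_realpow)
  have "lam < 1"
    using lam_q \<open>base < 1\<close> one_le_power[of lam q] by (cases "1 \<le> lam") auto

  have contract: "norm (e i (t + q)) \<le> lam ^ q * E"
    if "1 \<le> t" "\<And>j. j \<in> U \<Longrightarrow> norm (e j t) \<le> E" "i \<in> U" for t i E
  proof -
    let ?c = "card (covering_ends U (\<lambda>l i. N i (t + l)) {} q i)"
    have "0 \<le> E"
      using that(2)[OF that(3)] norm_ge_zero order_trans by blast
    have "card U - 1 \<le> ?c"
      unfolding q(1)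
    proof (rule card_covering_ends_ge)
      show "\<exists>i\<in>S. \<not> N i (t + k) \<subseteq> S" if "S \<subset> U" "S \<noteq> {}" for k S
        using neighbor_graph_expands[OF N_conn, of "t + k" S] that \<open>1 \<le> t\<close> by (simp add: U_def)
    qed (use NU that in \<open>auto simp: U_def\<close>)
    then have "real m - 1 \<le> real ?c"
      by (simp add: U_def)
    then have "1 - (1 - rho m P) * real ?c / real m ^ q \<le> base"
      unfolding base_def using \<open>rho m P < 1\<close>
      by (subst mult.commute) (intro diff_left_mono divide_right_mono mult_right_mono, auto)
    then have "(1 - (1 - rho m P) * real ?c / real m ^ q) * E \<le> base * E"
      using \<open>0 \<le> E\<close> by (rule mult_right_mono)
    moreover have "norm (e i (t + q)) \<le> (1 - (1 - rho m P) * real ?c / real m ^ q) * E"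
      \<comment> \<open>The walk starts with no visited agents, so the product is \<open>P i\<close>
        alone, which fixes \<open>e i (t + q)\<close>.\<close>
      using walk_bound[OF that(1,2) \<open>0 \<le> E\<close>, of "[]" q i] that(1,3) Pe[of i "t + q"] by simp
    ultimately show ?thesis
      by (simp add: lam_q)
  qed

  \<comment> \<open>Geometric convergence\<close>
  define C where "C = (\<Sum>i\<in>U. \<Sum>t\<in>{1..q}. norm (e i t))"
  have bound: "norm (e i t) \<le> C / lam ^ q * lam ^ t" if "1 \<le> t" "i \<in> U" for i t
  proof (rule geometric_decay[where a = "\<lambda>i t. norm (e i t)" and U = U])
    show "0 \<le> C"
      by (simp add: C_def sum_nonneg)
    show "norm (e i t) \<le> C" if "i \<in> U" "1 \<le> t" "t \<le> q" for i t
    proof -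
      have "norm (e i t) \<le> (\<Sum>t\<in>{1..q}. norm (e i t))"
        using that by (intro member_le_sum) auto
      also have "\<dots> \<le> C"
        unfolding C_def using that
        by (intro member_le_sum[where f = "\<lambda>i. \<Sum>t\<in>{1..q}. norm (e i t)"]) (auto simp: U_def sum_nonneg)
      finally show ?thesis .
    qed
  qed (use \<open>0 < lam\<close> \<open>lam < 1\<close> q(2) contract that in auto)

  show ?thesis
  proof (intro ballI conjI)
    fix i
    assume "i \<in> {1..m}"
    then have i: "i \<in> U"
      by (simp add: U_def)
    show "converges_as_fast (x i) xstar (rate m P)"
      unfolding converges_as_fast_def using bound[OF _ i] unfolding e_def lam_def by blast
    have "(\<lambda>t. C / lam ^ q * lam ^ t) \<longlonglongrightarrow> 0"
      using \<open>0 < lam\<close> \<open>lam < 1\<close> by (intro tendsto_mult_right_zero LIMSEQ_power_zero) auto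
    moreover have "\<forall>\<^sub>F t in sequentially. norm (e i t) \<le> C / lam ^ q * lam ^ t"
      using bound[OF _ i] by (rule eventually_sequentiallyI)
    ultimately have "(\<lambda>t. e i t) \<longlonglongrightarrow> 0"
      by (rule Lim_null_comparison[rotated])
    then show "x i \<longlonglongrightarrow> xstar"
      unfolding e_def by (subst LIM_zero_iff[symmetric])
  qed
qed

end
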